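(* Let $F=(f_1,\ldots,f_m)^\top:\mathbb{R}^n\to\mathbb{R}^m$ be continuously differentiable, let $s\in\mathbb{N}$ with $1\le s<n$, and let $\Omega=\{x\in\mathbb{R}^n\mid \|x\|_0\le s\}$. Assume that for every $j\in\{1,\ldots,m\}$ the gradient $\nabla f_j$ is Lipschitz-continuous over $\mathbb{R}^n$ with constant $L(f_j)$, i.e. $\|\nabla f_j(x)-\nabla f_j(y)\|\le L(f_j)\|x-y\|$ for all $x,y\in\mathbb{R}^n$. Let $\bar x\in\Omega$ be a weakly Pareto optimal point for the problem $\min_{x\in\Omega}F(x)$ and let $L>\max_{j=1,\ldots,m}L(f_j)$. Then $\bar x$ is $L$-stationary for the problem $\min_{x\in\Omega}F(x)$. Moreover, $v_L(\bar x)=\{\boldsymbol{0}_n\}$, i.e. the set $v_L(\bar x)$ is a singleton consisting of the zero vector of $\mathbb{R}^n$.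
   Context: $\|x\|_0$ denotes the number of nonzero components of $x$, and $\|\cdot\|$ is the Euclidean norm. For $u,v\in\mathbb{R}^m$, $u<v$ means $u_j<v_j$ for all $j\in\{1,\ldots,m\}$. A point $\bar x\in\Omega$ is weakly Pareto optimal if there is no $y\in\Omega$ with $F(y)<F(\bar x)$. For $L>0$ and $\bar x\in\Omega$ let $\mathcal{D}_L(\bar x)=\{v\in\mathbb{R}^n\mid \bar x+v\in\Omega\}$ and $$\theta_L(\bar x)=\min_{d\in\mathcal{D}_L(\bar x)}\ \max_{j=1,\ldots,m}\nabla f_j(\bar x)^\top d+\frac{L}{2}\|d\|^2 ,$$ and let $v_L(\bar x)$ be the set of optimal solutions $d$ of this minimization problem. The point $\bar x\in\Omega$ is $L$-stationary if $\theta_L(\bar x)=0$. *)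

theory Defs
  imports "HOL-Analysis.Analysis"
begin

definition l0norm :: "real ^ 'n \<Rightarrow> nat"
  where "l0norm x = card {i. x $ i \<noteq> 0}"

definition sparse_set :: "nat \<Rightarrow> (real ^ 'n) set"
  where "sparse_set s = {x. l0norm x \<le> s}"

definition continuously_differentiable :: "('a::real_normed_vector \<Rightarrow> 'b::real_normed_vector) \<Rightarrow> bool"
  where "continuously_differentiable f \<longleftrightarrow>
    (\<exists>f' :: 'a \<Rightarrow> ('a \<Rightarrow>\<^sub>L 'b).
       (\<forall>x. (f has_derivative blinfun_apply (f' x)) (at x)) \<and> continuous_on UNIV f')"

definition gradient :: "('a::real_inner \<Rightarrow> real) \<Rightarrow> 'a \<Rightarrow> 'a"
  where "gradient f x = (THE g. GDERIV f x :> g)"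

lemma gradient_eqI:
  assumes "GDERIV f x :> g"
  shows "gradient f x = g"
  unfolding gradient_def
proof (rule the_equality)
  fix h assume "GDERIV f x :> h"
  with assms have "(\<lambda>v. inner v h) = (\<lambda>v. inner v g)"
    unfolding gderiv_def by (rule has_derivative_unique[rotated])
  then show "h = g"
    by (metis inner_commute vector_eq_rdot)
qed (rule assms)

(* The library order "<" on real ^ 'm is not the componentwise strict order,
   so the latter is written out. *)
definition weakly_Pareto_optimal ::
    "('a \<Rightarrow> real ^ 'm) \<Rightarrow> 'a set \<Rightarrow> 'a \<Rightarrow> bool"
  where "weakly_Pareto_optimal F \<Omega> x \<longleftrightarrow>
    x \<in> \<Omega> \<and> \<not> (\<exists>y\<in>\<Omega>. \<forall>j. F y $ j < F x $ j)"

definition feasible_directions :: "'a::real_vector set \<Rightarrow> 'a \<Rightarrow> 'a set"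
  where "feasible_directions \<Omega> x = {v. x + v \<in> \<Omega>}"

definition model ::
    "real \<Rightarrow> ('a::real_inner \<Rightarrow> real ^ 'm) \<Rightarrow> 'a \<Rightarrow> 'a \<Rightarrow> real"
  where "model L F x d =
    Max (range (\<lambda>j. gradient (\<lambda>y. F y $ j) x \<bullet> d)) + L / 2 * (norm d)\<^sup>2"

(* LEAST denotes the minimum of the set of values; for L > 0 and closed \<Omega> containing x
   in finite dimension it is attained, since the model is continuous and coercive. *)
definition theta ::
    "real \<Rightarrow> ('a::real_inner \<Rightarrow> real ^ 'm) \<Rightarrow> 'a set \<Rightarrow> 'a \<Rightarrow> real"
  where "theta L F \<Omega> x = (LEAST t. t \<in> model L F x ` feasible_directions \<Omega> x)"

definition optimal_directions ::
    "real \<Rightarrow> ('a::real_inner \<Rightarrow> real ^ 'm) \<Rightarrow> 'a set \<Rightarrow> 'a \<Rightarrow> 'a set"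
  where "optimal_directions L F \<Omega> x =
    {d. is_arg_min (model L F x) (\<lambda>d. d \<in> feasible_directions \<Omega> x) d}"

definition L_stationary ::
    "real \<Rightarrow> ('a::real_inner \<Rightarrow> real ^ 'm) \<Rightarrow> 'a set \<Rightarrow> 'a \<Rightarrow> bool"
  where "L_stationary L F \<Omega> x \<longleftrightarrow> x \<in> \<Omega> \<and> theta L F \<Omega> x = 0"

end

theory Submission
  imports Defs
begin

text \<open>By the descent lemma, a nonzero feasible direction \<open>d\<close> at which the model is
  nonpositive satisfies \<open>f\<^sub>j (x + d) < f\<^sub>j x\<close> for every \<open>j\<close>, because \<open>L\<close> exceeds all
  Lipschitz constants. At a weakly Pareto optimal point the model is therefore positive at
  every nonzero feasible direction, while it vanishes at \<open>0\<close>.\<close>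

text \<open>Since \<open>gradient\<close> is a definite description, it is meaningful only once some
  gradient is known to exist. Each component of the derivative is a linear functional on a
  finite-dimensional space, hence an inner product with a fixed vector.\<close>

lemma GDERIV_gradient_component:
  fixes F :: "real ^ 'n \<Rightarrow> real ^ 'm"
  assumes "continuously_differentiable F"
  shows "GDERIV (\<lambda>y. F y $ j) x :> gradient (\<lambda>y. F y $ j) x"
proof -
  obtain f' where "(F has_derivative blinfun_apply (f' x)) (at x)"
    using assms unfolding continuously_differentiable_def by blast
  then have D: "((\<lambda>y. F y $ j) has_derivative (\<lambda>v. f' x v $ j)) (at x)"
    by (rule bounded_linear.has_derivative[OF bounded_linear_vec_nth])
  then have lin: "linear (\<lambda>v. f' x v $ j)"
    by (rule has_derivative_linear)
  \<comment> \<open>The adjoint of a functional, evaluated at \<open>1\<close>, is its Riesz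
    representative.\<close>
  have "(\<lambda>v. f' x v $ j) = (\<lambda>v. v \<bullet> adjoint (\<lambda>v. f' x v $ j) 1)"
    by (simp add: adjoint_works[OF lin])
  with D have "GDERIV (\<lambda>y. F y $ j) x :> adjoint (\<lambda>v. f' x v $ j) 1"
    by (simp add: gderiv_def)
  then show ?thesis
    using gradient_eqI by metis
qed

text \<open>Along the segment from \<open>x\<close> to \<open>x + d\<close>, the gap between
  \<open>f\<close> and its quadratic upper model cannot increase, because its derivative is
  nonpositive by the Lipschitz bound.\<close>

lemma descent_lemma:
  fixes f :: "'a::real_inner \<Rightarrow> real" and g :: "'a \<Rightarrow> 'a"
  assumes deriv: "\<And>x. GDERIV f x :> g x"
    and lip: "\<And>x y. norm (g x - g y) \<le> K * norm (x - y)"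
  shows "f (x + d) \<le> f x + g x \<bullet> d + K / 2 * (norm d)\<^sup>2"
proof -
  \<comment> \<open>Chosen so that \<open>\<phi> 0 = f x\<close> and
    \<open>\<phi> 1 \<le> \<phi> 0\<close> is a rearrangement of the claim.\<close>
  define \<phi> where "\<phi> t = f (x + t *\<^sub>R d) - t * (g x \<bullet> d) - K / 2 * t\<^sup>2 * (norm d)\<^sup>2" for t
  have "\<phi> 1 \<le> \<phi> 0"
  proof (rule DERIV_nonpos_imp_nonincreasing[where f = \<phi>])
    fix t :: real
    assume t: "0 \<le> t" "t \<le> 1"
    have line: "((\<lambda>t. x + t *\<^sub>R d) has_derivative (\<lambda>h. h *\<^sub>R d)) (at t)"
      by (auto intro!: derivative_eq_intros)
    have "((\<lambda>t. f (x + t *\<^sub>R d)) has_derivative (\<lambda>h. (h *\<^sub>R d) \<bullet> g (x + t *\<^sub>R d))) (at t)"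
      using has_derivative_compose[OF line deriv[unfolded gderiv_def]] .
    then have "((\<lambda>t. f (x + t *\<^sub>R d)) has_real_derivative g (x + t *\<^sub>R d) \<bullet> d) (at t)"
      by (rule has_derivative_imp_has_field_derivative) (simp add: inner_commute)
    then have D: "(\<phi> has_real_derivative
        g (x + t *\<^sub>R d) \<bullet> d - g x \<bullet> d - K * t * (norm d)\<^sup>2) (at t)"
      unfolding \<phi>_def by (auto intro!: derivative_eq_intros)
    \<comment> \<open>Cauchy-Schwarz and the Lipschitz bound at distance \<open>t * norm d\<close>
      give exactly the quadratic term's contribution to the derivative of
      \<open>\<phi>\<close>.\<close>
    have "g (x + t *\<^sub>R d) \<bullet> d - g x \<bullet> d \<le> norm (g (x + t *\<^sub>R d) - g x) * norm d"
      by (metis inner_diff_left norm_cauchy_schwarz)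
    also have "\<dots> \<le> K * norm (t *\<^sub>R d) * norm d"
      using lip[of "x + t *\<^sub>R d" x] by (simp add: mult_right_mono)
    also have "\<dots> = K * t * (norm d)\<^sup>2"
      using t by (simp add: power2_eq_square)
    finally show "\<exists>y. (\<phi> has_real_derivative y) (at t) \<and> y \<le> 0"
      using D by (intro exI[of _ "g (x + t *\<^sub>R d) \<bullet> d - g x \<bullet> d - K * t * (norm d)\<^sup>2"]) auto
  qed simp
  then show ?thesis
    by (simp add: \<phi>_def)
qed

lemma model_zero: "model L F x 0 = 0"
  by (simp add: model_def)

lemma model_pos_if_weakly_Pareto_optimal:
  fixes F :: "real ^ 'n \<Rightarrow> real ^ 'm"
  assumes "continuously_differentiable F"
    and lip: "\<And>j x y. norm (gradient (\<lambda>z. F z $ j) x - gradient (\<lambda>z. F z $ j) y)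
                    \<le> Lc j * norm (x - y)"
    and opt: "weakly_Pareto_optimal F \<Omega> x"
    and L: "L > Max (range Lc)"
    and d: "d \<in> feasible_directions \<Omega> x" "d \<noteq> 0"
  shows "model L F x d > 0"
proof (rule ccontr)
  assume "\<not> model L F x d > 0"
  have "F (x + d) $ j < F x $ j" for j
  proof -
    let ?g = "gradient (\<lambda>y. F y $ j)"
    have "F (x + d) $ j \<le> F x $ j + ?g x \<bullet> d + Lc j / 2 * (norm d)\<^sup>2"
      by (rule descent_lemma[OF GDERIV_gradient_component[OF assms(1)] lip])
    also have "Lc j < L"
      using L by simp
    \<comment> \<open>The strict inequality of the chain: \<open>d \<noteq> 0\<close> makes the
      squared norm positive, so the gap between \<open>Lc j\<close> and \<open>L\<close>
      survives.\<close>
    then have "Lc j / 2 * (norm d)\<^sup>2 < L / 2 * (norm d)\<^sup>2"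
      using d by (intro mult_strict_right_mono) auto
    also have "F x $ j + ?g x \<bullet> d + L / 2 * (norm d)\<^sup>2 \<le> F x $ j + model L F x d"
      by (simp add: model_def)
    also have "\<dots> \<le> F x $ j"
      using \<open>\<not> model L F x d > 0\<close> by simp
    finally show ?thesis
      by simp
  qed
  then show False
    using opt d by (auto simp: weakly_Pareto_optimal_def feasible_directions_def)
qed

theorem proposition2:
  fixes F :: "real ^ 'n \<Rightarrow> real ^ 'm"
    and s :: nat
    and \<Omega> :: "(real ^ 'n) set"
    and Lc :: "'m \<Rightarrow> real"
    and L :: real
    and xbar :: "real ^ 'n"
  assumes "continuously_differentiable F"
    and "1 \<le> s" and "s < CARD('n)"
    and "\<Omega> = sparse_set s"
    and "\<And>j x y. norm (gradient (\<lambda>z. F z $ j) x - gradient (\<lambda>z. F z $ j) y)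
                    \<le> Lc j * norm (x - y)"
    and "weakly_Pareto_optimal F \<Omega> xbar"
    and "L > Max (range Lc)"
  shows "L_stationary L F \<Omega> xbar \<and> optimal_directions L F \<Omega> xbar = {0}"
proof
  have "xbar \<in> \<Omega>"
    using assms(6) by (simp add: weakly_Pareto_optimal_def)
  then have zero: "0 \<in> feasible_directions \<Omega> xbar"
    by (simp add: feasible_directions_def)
  have pos: "model L F xbar d > 0" if "d \<in> feasible_directions \<Omega> xbar" "d \<noteq> 0" for d
    using model_pos_if_weakly_Pareto_optimal[OF assms(1,5,6,7) that] .
  have nonneg: "model L F xbar d \<ge> 0" if "d \<in> feasible_directions \<Omega> xbar" for d
    using pos[OF that] model_zero[of L F xbar] by (cases "d = 0") auto
  have "theta L F \<Omega> xbar = 0"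
    unfolding theta_def
  \<comment> \<open>The minimum is exhibited directly: the zero direction attains the value
    \<open>0\<close>, and \<open>nonneg\<close> makes it a lower bound.\<close>
  proof (rule Least_equality)
    show "0 \<in> model L F xbar ` feasible_directions \<Omega> xbar"
      using zero model_zero[of L F xbar] by (metis imageI)
  qed (use nonneg in auto)
  with \<open>xbar \<in> \<Omega>\<close> show "L_stationary L F \<Omega> xbar"
    by (simp add: L_stationary_def)
  show "optimal_directions L F \<Omega> xbar = {0}"
    \<comment> \<open>A minimizer cannot have a value above that of the zero direction, so
      \<open>pos\<close> excludes every nonzero one.\<close>
    using zero pos nonneg model_zero[of L F xbar]
    unfolding optimal_directions_def is_arg_min_def by force
qed

end
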